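(* Let $1\le n<P$, let $G=\{0,\dots,P-1\}$, let $F\subset G$ with $|F|=P-n$, and let $S_2\subset\{0,1\}^P$ be an arbitrary set of binary strings with $|S_2|=2^n$. Let $S_3\subset\{0,1\}^P$ be a target set constructed from $S_2$ and $F$ according to the mode-based rule (see context). Then a bijection $\phi:S_2\to S_3$ that minimizes $$\sum_{x\in S_2}D_H(x,\phi(x))$$ over all bijections $S_2\to S_3$ can be obtained by solving a linear assignment problem over the unmatched subsets $S_2'=S_2\setminus S_3$ and $S_3'=S_3\setminus S_2$ while fixing the identity mapping on $S_2\cap S_3$. Explicitly: $|S_2'|=|S_3'|$, and if $(x_{ab})_{a\in S_2',\,b\in S_3'}$ is an optimal solution of $$\min\ \sum_{a\in S_2'}\sum_{b\in S_3'}D_H(a,b)\,x_{ab}\quad\text{s.t.}\quad \sum_{b\in S_3'}x_{ab}=1\ \ \forall a\in S_2',\qquad \sum_{a\in S_2'}x_{ab}=1\ \ \forall b\in S_3',\qquad x_{ab}\in\{0,1\},$$ then the map $\phi$ defined by $\phi(x)=x$ for $x\in S_2\cap S_3$ and $\phi(a)=b$ iff $x_{ab}=1$ for $a\in S_2'$ is a bijection $S_2\to S_3$ which minimizes $\sum_{x\in S_2}D_H(x,\phi(x))$ among all bijections from $S_2$ to $S_3$.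
   Context: $D_H(x,y)=\sum_{i}(x_i\oplus y_i)$ is the Hamming distance between binary strings of equal length. Mode-based rule: given $S_2=\{a^j\}_{j=0}^{2^n-1}\subset\{0,1\}^P$ (distinct strings) and $F\subset G$ with $|F|=P-n$, let $a^j_F\in\{0,1\}^F$ be the restriction of $a^j$ to the indices in $F$, and let $\tilde a=\operatorname{mode}(\{a^j_F\}_{j=0}^{2^n-1})$ be a most frequent pattern among the restrictions $a^0_F,\dots,a^{2^n-1}_F$ counted with multiplicity (any choice in case of ties). The target set is $$S_3=\{\,b\in\{0,1\}^P:\ b_i=\tilde a_i\ \text{for all } i\in F\,\},$$ i.e. the bits in $F$ are fixed to $\tilde a$ and the bits in $G\setminus F$ run over all $2^n$ binary strings; thus $|S_3|=2^n$. *)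

theory Defs
  imports Complex_Main "HOL-Library.FuncSet" "HOL-Library.Multiset"
begin

definition bit_strings :: "nat \<Rightarrow> bool list set" where
  "bit_strings P = {x. length x = P}"

(* On truth values, exclusive or is inequality. Meant for lists of equal length. *)
definition hamming_dist :: "bool list \<Rightarrow> bool list \<Rightarrow> nat" where
  "hamming_dist x y = (\<Sum>i<length x. of_bool (x ! i \<noteq> y ! i))"

(* Patterns on F are extensional functions, so that patterns agreeing on F are equal. *)
definition bit_pattern :: "nat set \<Rightarrow> bool list \<Rightarrow> nat \<Rightarrow> bool" where
  "bit_pattern F x = restrict (\<lambda>i. x ! i) F"

(* A mode need not be unique: any most frequent element qualifies. *)
definition is_mode :: "'a \<Rightarrow> 'a multiset \<Rightarrow> bool" where
  "is_mode m M \<longleftrightarrow> m \<in># M \<and> (\<forall>y. count M y \<le> count M m)"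

definition mode_based_target :: "nat \<Rightarrow> nat set \<Rightarrow> bool list set \<Rightarrow> bool list set \<Rightarrow> bool" where
  "mode_based_target P F S2 S3 \<longleftrightarrow>
     (\<exists>m. is_mode m (image_mset (bit_pattern F) (mset_set S2)) \<and>
          S3 = {b \<in> bit_strings P. \<forall>i\<in>F. b ! i = m i})"

definition lap_feasible :: "'a set \<Rightarrow> 'b set \<Rightarrow> ('a \<Rightarrow> 'b \<Rightarrow> real) \<Rightarrow> bool" where
  "lap_feasible A B x \<longleftrightarrow>
     (\<forall>a\<in>A. (\<Sum>b\<in>B. x a b) = 1) \<and>
     (\<forall>b\<in>B. (\<Sum>a\<in>A. x a b) = 1) \<and>
     (\<forall>a\<in>A. \<forall>b\<in>B. x a b \<in> {0, 1})"

definition lap_optimal ::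
  "'a set \<Rightarrow> 'b set \<Rightarrow> ('a \<Rightarrow> 'b \<Rightarrow> real) \<Rightarrow> ('a \<Rightarrow> 'b \<Rightarrow> real) \<Rightarrow> bool" where
  "lap_optimal A B c x \<longleftrightarrow>
     is_arg_min (\<lambda>x. \<Sum>a\<in>A. \<Sum>b\<in>B. c a b * x a b) (lap_feasible A B) x"

(* Only the values on S are relevant. *)
definition lap_map :: "'a set \<Rightarrow> 'a set \<Rightarrow> ('a \<Rightarrow> 'a \<Rightarrow> real) \<Rightarrow> 'a \<Rightarrow> 'a" where
  "lap_map S T x a = (if a \<in> S \<inter> T then a else (THE b. b \<in> T - S \<and> x a b = 1))"

definition min_cost_bijection ::
  "('a \<Rightarrow> 'b \<Rightarrow> nat) \<Rightarrow> 'a set \<Rightarrow> 'b set \<Rightarrow> ('a \<Rightarrow> 'b) \<Rightarrow> bool" where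
  "min_cost_bijection d S T \<phi> \<longleftrightarrow>
     is_arg_min (\<lambda>\<psi>. \<Sum>x\<in>S. d x (\<psi> x)) (\<lambda>\<psi>. bij_betw \<psi> S T) \<phi>"

end

theory Submission
  imports Defs "HOL-Combinatorics.Transposition"
begin

text \<open>
  Feasible 0/1 solutions of the assignment problem are the same thing as bijections, with the same
  cost, so only one point needs an argument: some optimal bijection fixes \<open>S \<inter> T\<close> pointwise. If
  \<open>\<psi> z = x \<noteq> \<psi> x\<close> with \<open>x \<in> S \<inter> T\<close>, then sending \<open>x\<close> to itself and \<open>z\<close> to \<open>\<psi> x\<close> does not
  increase the cost by the triangle inequality.
\<close>

section \<open>Hamming distance and the size of the target set\<close>

lemma hamming_dist_self: "hamming_dist x x = 0"
  by (simp add: hamming_dist_def)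

text \<open>Each sum ranges over the length of its first argument. Once \<open>x\<close> and
  \<open>y\<close> have equal length all three index sets coincide, and the inequality holds index
  by index.\<close>

lemma hamming_dist_triangle:
  assumes "length x = length y"
  shows "hamming_dist x z \<le> hamming_dist x y + hamming_dist y z"
  unfolding hamming_dist_def assms sum.distrib[symmetric]
  by (rule sum_mono) (auto simp: of_bool_def)

lemma finite_bit_strings: "finite (bit_strings P)"
  using finite_lists_length_eq[of "UNIV :: bool set" P] by (simp add: bit_strings_def)

text \<open>A string with prescribed bits on \<open>F\<close> is determined by the set of free
  positions where it is true, so such strings correspond to the subsets of the complement of
  \<open>F\<close>.\<close>

lemma card_bit_strings_fixed:
  assumes "F \<subseteq> {0..<P}"
  shows "card {b \<in> bit_strings P. \<forall>i\<in>F. b ! i = m i} = 2 ^ (P - card F)"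
proof -
  let ?G = "{0..<P} - F"
  let ?f = "\<lambda>A. map (\<lambda>i. if i \<in> F then m i else i \<in> A) [0..<P]"
  have "bij_betw ?f (Pow ?G) {b \<in> bit_strings P. \<forall>i\<in>F. b ! i = m i}"
    using assms
    by (intro bij_betw_byWitness[where f' = "\<lambda>b. {i \<in> ?G. b ! i}"])
      (auto simp: bit_strings_def subset_iff intro!: nth_equalityI)
  then have "card {b \<in> bit_strings P. \<forall>i\<in>F. b ! i = m i} = card (Pow ?G)"
    by (simp add: bij_betw_same_card)
  also have "\<dots> = 2 ^ (P - card F)"
    using assms by (simp add: card_Pow card_Diff_subset finite_subset)
  finally show ?thesis .
qed

lemma finite_card_mode_based_target:
  assumes "mode_based_target P F S S'" and "F \<subseteq> {0..<P}"
  shows "finite S'" and "card S' = 2 ^ (P - card F)"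
  using assms card_bit_strings_fixed[of F P] finite_bit_strings[of P]
  unfolding mode_based_target_def by auto

section \<open>Assignment matrices and bijections\<close>

lemma ex1_eq_1_if_sum_eq_1:
  fixes f :: "'a \<Rightarrow> real"
  assumes "finite A" and "\<And>a. a \<in> A \<Longrightarrow> f a \<in> {0, 1}" and "sum f A = 1"
  shows "\<exists>!a. a \<in> A \<and> f a = 1"
proof -
  \<comment> \<open>A value in {0, 1} is the indicator of being one, so the sum counts the
    ones.\<close>
  have "sum f A = (\<Sum>a\<in>A. of_bool (f a = 1))"
    using assms(2) by (intro sum.cong) auto
  also have "\<dots> = real (card {a \<in> A. f a = 1})"
    using assms(1) by (simp add: sum.If_cases of_bool_def Collect_conj_eq Int_commute)
  finally have "card {a \<in> A. f a = 1} = 1"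
    using assms(3) by simp
  then obtain a where "{a \<in> A. f a = 1} = {a}"
    by (auto simp: card_1_singleton_iff)
  then have "a' \<in> A \<and> f a' = 1 \<longleftrightarrow> a' = a" for a'
    by auto
  then show ?thesis
    by simp
qed

text \<open>This is the permutation matrix of \<open>\<psi>\<close>: rows sum to one because
  \<open>\<psi>\<close> is a function into \<open>B\<close>, columns because every \<open>b\<close>
  has exactly one preimage.\<close>

lemma lap_feasible_of_bij_betw:
  assumes "bij_betw \<psi> A B" and "finite A" and "finite B"
  shows "lap_feasible A B (\<lambda>a b. of_bool (\<psi> a = b))"
proof -
  have "(\<Sum>a\<in>A. of_bool (\<psi> a = b)) = (1 :: real)" if "b \<in> B" for b
  proof -
    obtain a where a: "a \<in> A" "\<psi> a = b"
      using assms(1) \<open>b \<in> B\<close> by (auto simp: bij_betw_def)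
    then have "\<psi> a' = b \<longleftrightarrow> a' = a" if "a' \<in> A" for a'
      using assms(1) that by (auto simp: bij_betw_def inj_on_def)
    then have "(\<Sum>a'\<in>A. of_bool (\<psi> a' = b)) = (\<Sum>a'\<in>A. of_bool (a' = a) :: real)"
      by (intro sum.cong) auto
    then show ?thesis
      using a(1) assms(2) by (simp add: of_bool_def)
  qed
  then show ?thesis
    using assms by (auto simp: lap_feasible_def of_bool_def bij_betw_def)
qed

lemma lap_cost_of_function:
  fixes c :: "'a \<Rightarrow> 'b \<Rightarrow> real"
  assumes "\<psi> ` A \<subseteq> B" and "finite B"
  shows "(\<Sum>a\<in>A. \<Sum>b\<in>B. c a b * of_bool (\<psi> a = b)) = (\<Sum>a\<in>A. c a (\<psi> a))"
  using assms by (intro sum.cong) (auto simp: of_bool_def if_distrib cong: if_cong)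

text \<open>The row constraints make the matrix the graph of a function; the column constraints make
  that function injective and surjective.\<close>

lemma lap_feasible_bij_betw_ex:
  assumes "lap_feasible A B x" and "finite A" and "finite B"
  obtains \<psi> where "bij_betw \<psi> A B" and "\<And>a b. a \<in> A \<Longrightarrow> b \<in> B \<Longrightarrow> x a b = of_bool (\<psi> a = b)"
proof -
  have row: "\<exists>!b. b \<in> B \<and> x a b = 1" if "a \<in> A" for a
    using assms that by (intro ex1_eq_1_if_sum_eq_1) (auto simp: lap_feasible_def)
  have col: "\<exists>!a. a \<in> A \<and> x a b = 1" if "b \<in> B" for b
    using assms that by (intro ex1_eq_1_if_sum_eq_1) (auto simp: lap_feasible_def)
  obtain \<psi> where \<psi>: "\<And>a. a \<in> A \<Longrightarrow> \<psi> a \<in> B \<and> x a (\<psi> a) = 1"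
    using row by metis
  have "inj_on \<psi> A"
    using col \<psi> by (metis inj_onI)
  moreover have "\<psi> ` A = B"
    \<comment> \<open>Column \<open>b\<close> provides some \<open>a\<close> with
      \<open>x a b = 1\<close>; uniqueness in row \<open>a\<close> then forces
      \<open>\<psi> a = b\<close>.\<close>
    using row col \<psi> by (auto, metis imageI)
  moreover have "x a b = of_bool (\<psi> a = b)" if "a \<in> A" "b \<in> B" for a b
  proof -
    have "x a b \<in> {0, 1}"
      using assms(1) that by (simp add: lap_feasible_def)
    then show ?thesis
      using row[OF that(1)] \<psi>[OF that(1)] that(2) by auto
  qed
  ultimately show thesis
    using that by (auto simp: bij_betw_def)
qed

section \<open>Transfer of optimality between matrices and bijections\<close>

lemma min_cost_bijection_ex:
  assumes "finite S" and "finite T" and "card S = card T"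
  obtains \<phi> where "min_cost_bijection d S T \<phi>"
proof -
  obtain \<psi> where "bij_betw \<psi> S T"
    using finite_same_card_bij[OF assms] by blast
  \<comment> \<open>Functions may vary freely outside \<open>S\<close>, so the minimum comes from
    the well-ordering of the natural-number costs rather than from finitely many candidates.\<close>
  then show thesis
    using that ex_has_least_nat[of "\<lambda>\<psi>. bij_betw \<psi> S T" \<psi> "\<lambda>\<psi>. \<Sum>x\<in>S. d x (\<psi> x)"]
    by (auto simp: min_cost_bijection_def is_arg_min_linorder)
qed

text \<open>Every competing matrix comes from a bijection of the same cost. This yields an optimal
  solution of the assignment problem, so a claim about all optimal solutions is not vacuous.\<close>

lemma lap_optimal_of_min_cost_bijection:
  fixes d :: "'a \<Rightarrow> 'b \<Rightarrow> nat"
  assumes "finite A" and "finite B" and "min_cost_bijection d A B \<psi>"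
  shows "lap_optimal A B (\<lambda>a b. real (d a b)) (\<lambda>a b. of_bool (\<psi> a = b))"
    (is "lap_optimal A B ?c ?x")
proof -
  have bij: "bij_betw \<psi> A B"
    and least: "\<And>\<psi>'. bij_betw \<psi>' A B \<Longrightarrow> (\<Sum>a\<in>A. d a (\<psi> a)) \<le> (\<Sum>a\<in>A. d a (\<psi>' a))"
    using assms(3) by (auto simp: min_cost_bijection_def is_arg_min_linorder)
  have "(\<Sum>a\<in>A. \<Sum>b\<in>B. ?c a b * ?x a b) \<le> (\<Sum>a\<in>A. \<Sum>b\<in>B. ?c a b * y a b)"
    if y: "lap_feasible A B y" for y
  proof -
    obtain \<psi>' where \<psi>': "bij_betw \<psi>' A B"
        "\<And>a b. a \<in> A \<Longrightarrow> b \<in> B \<Longrightarrow> y a b = of_bool (\<psi>' a = b)"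
      using lap_feasible_bij_betw_ex[OF y assms(1,2)] by blast
    have "(\<Sum>a\<in>A. \<Sum>b\<in>B. ?c a b * y a b) = (\<Sum>a\<in>A. \<Sum>b\<in>B. ?c a b * of_bool (\<psi>' a = b))"
      using \<psi>'(2) by (intro sum.cong) auto
    also have "\<dots> = real (\<Sum>a\<in>A. d a (\<psi>' a))"
      using \<psi>'(1) assms(2) by (subst lap_cost_of_function) (auto simp: bij_betw_def)
    finally have "(\<Sum>a\<in>A. \<Sum>b\<in>B. ?c a b * y a b) = real (\<Sum>a\<in>A. d a (\<psi>' a))" .
    moreover have "(\<Sum>a\<in>A. \<Sum>b\<in>B. ?c a b * ?x a b) = real (\<Sum>a\<in>A. d a (\<psi> a))"
      using bij assms(2) by (subst lap_cost_of_function) (auto simp: bij_betw_def)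
    ultimately show ?thesis
      using least[OF \<psi>'(1)] by (simp only: of_nat_le_iff)
  qed
  then show ?thesis
    using lap_feasible_of_bij_betw[OF bij assms(1,2)]
    by (simp add: lap_optimal_def is_arg_min_linorder)
qed

text \<open>Every competing bijection is turned into its permutation matrix, to which optimality of
  \<open>x\<close> applies.\<close>

lemma lap_optimal_min_cost_bijection:
  fixes d :: "'a \<Rightarrow> 'b \<Rightarrow> nat"
  assumes "finite A" and "finite B" and "lap_optimal A B (\<lambda>a b. real (d a b)) x"
  obtains \<psi> where "min_cost_bijection d A B \<psi>"
    and "\<And>a b. a \<in> A \<Longrightarrow> b \<in> B \<Longrightarrow> x a b = of_bool (\<psi> a = b)"
proof -
  have feas: "lap_feasible A B x"
    and least: "\<And>y. lap_feasible A B y \<Longrightarrow>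
      (\<Sum>a\<in>A. \<Sum>b\<in>B. real (d a b) * x a b) \<le> (\<Sum>a\<in>A. \<Sum>b\<in>B. real (d a b) * y a b)"
    using assms(3) by (auto simp: lap_optimal_def is_arg_min_linorder)
  obtain \<psi> where \<psi>: "bij_betw \<psi> A B"
      "\<And>a b. a \<in> A \<Longrightarrow> b \<in> B \<Longrightarrow> x a b = of_bool (\<psi> a = b)"
    using lap_feasible_bij_betw_ex[OF feas assms(1,2)] by blast
  have "(\<Sum>a\<in>A. d a (\<psi> a)) \<le> (\<Sum>a\<in>A. d a (\<psi>' a))" if \<psi>': "bij_betw \<psi>' A B" for \<psi>'
  proof -
    have "(\<Sum>a\<in>A. \<Sum>b\<in>B. real (d a b) * x a b)
        = (\<Sum>a\<in>A. \<Sum>b\<in>B. real (d a b) * of_bool (\<psi> a = b))"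
      using \<psi>(2) by (intro sum.cong) auto
    also have "\<dots> = real (\<Sum>a\<in>A. d a (\<psi> a))"
      using \<psi>(1) assms(2) by (subst lap_cost_of_function) (auto simp: bij_betw_def)
    finally have "real (\<Sum>a\<in>A. d a (\<psi> a))
        \<le> (\<Sum>a\<in>A. \<Sum>b\<in>B. real (d a b) * of_bool (\<psi>' a = b))"
      using least[OF lap_feasible_of_bij_betw[OF \<psi>' assms(1,2)]] by simp
    also have "\<dots> = real (\<Sum>a\<in>A. d a (\<psi>' a))"
      using \<psi>' assms(2) by (subst lap_cost_of_function) (auto simp: bij_betw_def)
    finally show ?thesis
      by (simp only: of_nat_le_iff)
  qed
  then show thesis
    using that \<psi> by (auto simp: min_cost_bijection_def is_arg_min_linorder)
qed

section \<open>Fixing the intersection pointwise\<close>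

lemma bij_betw_fixing_le:
  fixes d :: "'a \<Rightarrow> 'a \<Rightarrow> nat"
  assumes "finite S" and "I \<subseteq> S \<inter> T" and "bij_betw \<psi> S T"
    and self: "\<And>x. x \<in> S \<inter> T \<Longrightarrow> d x x = 0"
    and tri: "\<And>x y z. x \<in> S \<Longrightarrow> y \<in> S \<inter> T \<Longrightarrow> z \<in> T \<Longrightarrow> d x z \<le> d x y + d y z"
  shows "\<exists>\<psi>'. bij_betw \<psi>' S T \<and> (\<forall>x\<in>I. \<psi>' x = x) \<and> (\<Sum>x\<in>S. d x (\<psi>' x)) \<le> (\<Sum>x\<in>S. d x (\<psi> x))"
proof -
  have "finite I"
    using assms(1,2) finite_subset by blast
  then show ?thesis
    using assms(2)
  \<comment> \<open>The points are repaired one at a time; \<open>I\<close> collects those already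
    fixed, while \<open>S\<close> and \<open>T\<close> stay put.\<close>
  proof (induction I)
    case empty
    then show ?case
      using assms(3) by auto
  next
    case (insert x I)
    then obtain \<chi> where \<chi>: "bij_betw \<chi> S T" "\<And>x. x \<in> I \<Longrightarrow> \<chi> x = x"
        "(\<Sum>x\<in>S. d x (\<chi> x)) \<le> (\<Sum>x\<in>S. d x (\<psi> x))"
      by auto
    have x: "x \<in> S" "x \<in> T"
      using insert.prems by auto
    show ?case
    proof (cases "\<chi> x = x")
      case True
      then show ?thesis
        using \<chi> by auto
    next
      case False
      obtain z where z: "z \<in> S" "\<chi> z = x"
        using \<chi>(1) x(2) by (auto simp: bij_betw_def)
      \<comment> \<open>If \<open>z\<close> were in \<open>I\<close>, then
        \<open>z = \<chi> z = x\<close> would be in \<open>I\<close>. Hence the exchange disturbs no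
        point fixed earlier.\<close>
      then have zx: "z \<noteq> x" and "z \<notin> I"
        using False \<chi>(2) insert.hyps(2) by auto
      let ?\<chi> = "\<chi>(x := x, z := \<chi> x)"
      have "bij_betw ?\<chi> S T"
      proof -
        have "?\<chi> = \<chi> \<circ> transpose x z"
          using z(2) zx by (auto simp: fun_eq_iff transpose_def)
        moreover have "bij_betw (transpose x z) S S"
          using x(1) z(1) by simp
        ultimately show ?thesis
          using \<chi>(1) bij_betw_trans by metis
      qed
      moreover have "\<forall>y\<in>insert x I. ?\<chi> y = y"
        using \<chi>(2) zx \<open>z \<notin> I\<close> by auto
      moreover have "(\<Sum>y\<in>S. d y (?\<chi> y)) \<le> (\<Sum>y\<in>S. d y (\<chi> y))"
      proof -
        \<comment> \<open>Only the terms at \<open>x\<close> and \<open>z\<close> change: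
          \<open>d x (\<chi> x) + d z x\<close> becomes \<open>d x x + d z (\<chi> x)\<close>, where
          \<open>d x x = 0\<close>.\<close>
        have split: "sum f S = f x + f z + sum f (S - {x, z})" for f :: "'a \<Rightarrow> nat"
          using assms(1) x(1) z(1) zx sum.subset_diff[of "{x, z}" S f] by auto
        have "sum (\<lambda>y. d y (?\<chi> y)) (S - {x, z}) = sum (\<lambda>y. d y (\<chi> y)) (S - {x, z})"
          by (intro sum.cong) auto
        moreover have "d z (\<chi> x) \<le> d z x + d x (\<chi> x)"
          using tri[of z x "\<chi> x"] x z(1) \<chi>(1) by (auto simp: bij_betw_def)
        ultimately show ?thesis
          using zx x z(2) self[of x] by (simp add: split)
      qed
      ultimately show ?thesis
        using \<chi>(3) by (meson order_trans)
    qed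
  qed
qed

text \<open>A competitor is first replaced by one fixing \<open>S \<inter> T\<close> at no greater
  cost. That one restricts to a bijection of the differences, where \<open>\<phi>\<close> is
  optimal, and the fixed points cost nothing.\<close>

lemma min_cost_bijection_extend_by_identity:
  fixes d :: "'a \<Rightarrow> 'a \<Rightarrow> nat"
  assumes "finite S"
    and self: "\<And>x. x \<in> S \<inter> T \<Longrightarrow> d x x = 0"
    and tri: "\<And>x y z. x \<in> S \<Longrightarrow> y \<in> S \<inter> T \<Longrightarrow> z \<in> T \<Longrightarrow> d x z \<le> d x y + d y z"
    and min: "min_cost_bijection d (S - T) (T - S) \<phi>"
    and fixed: "\<And>x. x \<in> S \<inter> T \<Longrightarrow> \<phi> x = x"
  shows "min_cost_bijection d S T \<phi>"
proof -
  have bij: "bij_betw \<phi> (S - T) (T - S)"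
    and least: "\<And>\<psi>. bij_betw \<psi> (S - T) (T - S) \<Longrightarrow>
      (\<Sum>x\<in>S - T. d x (\<phi> x)) \<le> (\<Sum>x\<in>S - T. d x (\<psi> x))"
    using min by (auto simp: min_cost_bijection_def is_arg_min_linorder)
  have ST: "(S - T) \<union> (S \<inter> T) = S" "(T - S) \<union> (S \<inter> T) = T"
    by auto
  have bij_id: "bij_betw \<psi> (S \<inter> T) (S \<inter> T)" if "\<forall>x\<in>S \<inter> T. \<psi> x = x" for \<psi>
    using that by (auto simp: bij_betw_def inj_on_def image_iff)
  have cost: "(\<Sum>x\<in>S. d x (\<psi> x)) = (\<Sum>x\<in>S - T. d x (\<psi> x))" if "\<forall>x\<in>S \<inter> T. \<psi> x = x" for \<psi>
    using assms(1) self that by (intro sum.mono_neutral_right) auto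
  have "bij_betw \<phi> S T"
    using bij_betw_combine[OF bij bij_id] fixed by (simp add: ST) blast
  moreover have "(\<Sum>x\<in>S. d x (\<phi> x)) \<le> (\<Sum>x\<in>S. d x (\<psi> x))" if \<psi>: "bij_betw \<psi> S T" for \<psi>
  proof -
    obtain \<psi>' where \<psi>': "bij_betw \<psi>' S T" "\<forall>x\<in>S \<inter> T. \<psi>' x = x"
        "(\<Sum>x\<in>S. d x (\<psi>' x)) \<le> (\<Sum>x\<in>S. d x (\<psi> x))"
      using bij_betw_fixing_le[of S "S \<inter> T" T \<psi> d] assms(1) \<psi> self tri by auto
    have "bij_betw \<psi>' (S - S \<inter> T) (T - S \<inter> T)"
      using \<psi>'(1) bij_id[OF \<psi>'(2)] by (intro bij_betw_DiffI) auto
    then have "bij_betw \<psi>' (S - T) (T - S)"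
      by (simp add: Diff_Int)
    then show ?thesis
      using least cost[OF \<psi>'(2)] cost[of \<phi>] fixed \<psi>'(3) by fastforce
  qed
  ultimately show ?thesis
    by (simp add: min_cost_bijection_def is_arg_min_linorder)
qed

text \<open>Serves to pass from the bijection read off a matrix to \<open>lap_map\<close>, which
  agrees with it on \<open>S2 - S3\<close>.\<close>

lemma min_cost_bijection_cong:
  assumes "\<And>x. x \<in> S \<Longrightarrow> \<phi> x = \<psi> x"
  shows "min_cost_bijection d S T \<phi> \<longleftrightarrow> min_cost_bijection d S T \<psi>"
  using bij_betw_cong[of S \<phi> \<psi> T] sum.cong[of S S "\<lambda>x. d x (\<phi> x)" "\<lambda>x. d x (\<psi> x)"] assms
  by (simp add: min_cost_bijection_def is_arg_min_def)

theorem theorem3: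
  fixes n P :: nat and F :: "nat set" and S2 S3 :: "bool list set"
  assumes "1 \<le> n" and "n < P"
    and "F \<subseteq> {0..<P}" and "card F = P - n"
    and "S2 \<subseteq> bit_strings P" and "card S2 = 2 ^ n"
    and "mode_based_target P F S2 S3"
  shows "card (S2 - S3) = card (S3 - S2) \<and>
    (\<exists>x. lap_optimal (S2 - S3) (S3 - S2) (\<lambda>a b. real (hamming_dist a b)) x) \<and>
    (\<forall>x. lap_optimal (S2 - S3) (S3 - S2) (\<lambda>a b. real (hamming_dist a b)) x \<longrightarrow>
       (\<forall>a \<in> S2 \<inter> S3. lap_map S2 S3 x a = a) \<and>
       (\<forall>a \<in> S2 - S3. \<forall>b \<in> S3 - S2. lap_map S2 S3 x a = b \<longleftrightarrow> x a b = 1) \<and>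
       bij_betw (lap_map S2 S3 x) S2 S3 \<and>
       min_cost_bijection hamming_dist S2 S3 (lap_map S2 S3 x))"
proof (intro conjI allI impI)
  note S3 = finite_card_mode_based_target[OF assms(7,3)]
  have fin: "finite S2" "finite S3"
    using assms(5) finite_subset[OF _ finite_bit_strings] S3(1) by auto
  \<comment> \<open>Since \<open>n < P\<close>, the truncated difference \<open>P - (P - n)\<close>
    is \<open>n\<close>.\<close>
  have "card S2 = card S3"
    using S3(2) assms(2,4,6) by simp
  then show card: "card (S2 - S3) = card (S3 - S2)"
    using fin by (simp add: card_Diff_subset_Int Int_commute)
  have fin': "finite (S2 - S3)" "finite (S3 - S2)"
    using fin by auto
  show "\<exists>x. lap_optimal (S2 - S3) (S3 - S2) (\<lambda>a b. real (hamming_dist a b)) x"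
    using min_cost_bijection_ex[OF fin' card] lap_optimal_of_min_cost_bijection[OF fin'] by metis
  fix x
  assume "lap_optimal (S2 - S3) (S3 - S2) (\<lambda>a b. real (hamming_dist a b)) x"
  then obtain \<psi> where \<psi>: "min_cost_bijection hamming_dist (S2 - S3) (S3 - S2) \<psi>"
    and x: "\<And>a b. a \<in> S2 - S3 \<Longrightarrow> b \<in> S3 - S2 \<Longrightarrow> x a b = of_bool (\<psi> a = b)"
    using lap_optimal_min_cost_bijection[OF fin'] by blast
  have \<psi>_bij: "bij_betw \<psi> (S2 - S3) (S3 - S2)"
    using \<psi> by (simp add: min_cost_bijection_def is_arg_min_def)
  have eq: "lap_map S2 S3 x a = \<psi> a" if a: "a \<in> S2 - S3" for a
  proof -
    have "\<psi> a \<in> S3 - S2"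
      using \<psi>_bij a bij_betwE by blast
    \<comment> \<open>Row \<open>a\<close> has its only one at \<open>\<psi> a\<close>, so the
      description is proper.\<close>
    then have "(THE b. b \<in> S3 - S2 \<and> x a b = 1) = \<psi> a"
      using x[OF a] by (intro the_equality) auto
    then show ?thesis
      using a by (simp add: lap_map_def)
  qed
  show "\<forall>a \<in> S2 - S3. \<forall>b \<in> S3 - S2. lap_map S2 S3 x a = b \<longleftrightarrow> x a b = 1"
    using eq x by simp
  show id: "\<forall>a \<in> S2 \<inter> S3. lap_map S2 S3 x a = a"
    by (simp add: lap_map_def)
  have "min_cost_bijection hamming_dist (S2 - S3) (S3 - S2) (lap_map S2 S3 x)"
    using \<psi> min_cost_bijection_cong[of "S2 - S3" "lap_map S2 S3 x" \<psi>] eq by blast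
  moreover have "hamming_dist a c \<le> hamming_dist a b + hamming_dist b c"
    if "a \<in> S2" "b \<in> S2 \<inter> S3" for a b c
    using that assms(5) by (intro hamming_dist_triangle) (auto simp: bit_strings_def)
  ultimately show "min_cost_bijection hamming_dist S2 S3 (lap_map S2 S3 x)"
    using fin(1) id min_cost_bijection_extend_by_identity[of S2 S3 hamming_dist "lap_map S2 S3 x"]
    by (simp add: hamming_dist_self)
  then show "bij_betw (lap_map S2 S3 x) S2 S3"
    by (simp add: min_cost_bijection_def is_arg_min_def)
qed

end
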